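(* Let $m,n$ be positive integers and let $\mathscr{P}_{n,m}=\mathscr{P}_n\times\mathbb{R}^{(m,n)}$, where $\mathscr{P}_n=\{Y\in\mathbb{R}^{(n,n)}: Y={}^tY>0\}$. Use coordinates $(Y,V)$ with $Y=(y_{ij})$ symmetric ($y_{ij}=y_{ji}$) and $V=(v_{kl})\in\mathbb{R}^{(m,n)}$, and set $$\frac{\partial}{\partial Y}=\left(\frac{1+\delta_{ij}}{2}\frac{\partial}{\partial y_{ij}}\right)_{1\le i,j\le n},\qquad \frac{\partial}{\partial V}=\left(\frac{\partial}{\partial v_{kl}}\right)_{1\le k\le m,\ 1\le l\le n}.$$ Define the differential operators on $\mathscr{P}_{n,m}$ $$D_j=\mathrm{Tr}\left(\left(2Y\frac{\partial}{\partial Y}\right)^j\right),\quad 1\le j\le n,$$ $$\Omega^{(0)}_{pq}=\left\{\frac{\partial}{\partial V}\,Y\,{}^t\!\left(\frac{\partial}{\partial V}\right)\right\}_{pq},\quad 1\le p\le q\le m,$$ where $\{M\}_{pq}$ denotes the $(p,q)$-entry of a matrix $M$. Then $$[D_i,D_j]=0\ \text{ for all } 1\le i,j\le n,$$ $$[\Omega^{(0)}_{kl},\Omega^{(0)}_{pq}]=0\ \text{ for all } 1\le k\le l\le m,\ 1\le p\le q\le m,$$ $$[D_1,\Omega^{(0)}_{pq}]=2\,\Omega^{(0)}_{pq}\ \text{ for all } 1\le p\le q\le m,$$ where $[A,B]=AB-BA$.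
   Context: These operators are invariant under the action of $GL(n,\mathbb{R})\ltimes\mathbb{R}^{(m,n)}$ on $\mathscr{P}_{n,m}$ given by $(A,a)\cdot(Y,V)=(AY\,{}^tA,(V+a)\,{}^tA)$. In the definition of $D_j$, the matrix $2Y\frac{\partial}{\partial Y}$ is a matrix of first-order differential operators (entries $\sum_k 2y_{ik}\frac{1+\delta_{kj}}{2}\frac{\partial}{\partial y_{kj}}$), its $j$-th power is the matrix product of operator-valued matrices, and $\mathrm{Tr}$ is the trace. Similarly $\frac{\partial}{\partial V}\,Y\,{}^t(\frac{\partial}{\partial V})$ is the $m\times m$ matrix of operators with $(p,q)$-entry $\sum_{a,b} y_{ab}\frac{\partial^2}{\partial v_{pa}\partial v_{qb}}$. *)

theory Defs
  imports "HOL-Analysis.Analysis"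
begin

type_synonym ('n,'m) pt = "(real^'n^'n) \<times> (real^'n^'m)"
type_synonym ('n,'m) op = "(('n,'m) pt \<Rightarrow> real) \<Rightarrow> (('n,'m) pt \<Rightarrow> real)"

definition Pnm :: "('n::finite,'m::finite) pt set" where
  "Pnm = {(Y,V). transpose Y = Y \<and> (\<forall>x::real^'n. x \<noteq> 0 \<longrightarrow> x \<bullet> (Y *v x) > 0)}"

definition dderiv :: "('a::real_normed_vector \<Rightarrow> real) \<Rightarrow> 'a \<Rightarrow> 'a \<Rightarrow> real" where
  "dderiv f d x = frechet_derivative f (at x) d"

fun Ck :: "nat \<Rightarrow> 'a::real_normed_vector set \<Rightarrow> ('a \<Rightarrow> real) \<Rightarrow> bool" where
  "Ck 0 U f = continuous_on U f"
| "Ck (Suc k) U f = (f differentiable_on U \<and> continuous_on U f \<and> (\<forall>d. Ck k U (dderiv f d)))"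

definition smooth_on :: "'a::real_normed_vector set \<Rightarrow> ('a \<Rightarrow> real) \<Rightarrow> bool" where
  "smooth_on U f = (\<forall>k. Ck k U f)"

text \<open>(d/dY)_{ij} = (1+delta_ij)/2 d/dy_ij: derivative in direction (E_ij + E_ji)/2 of the Y-component.\<close>
definition dY :: "'n::finite \<Rightarrow> 'n \<Rightarrow> ('n,'m::finite) op" where
  "dY i j f = dderiv f ((\<chi> a b. (if a = i \<and> b = j then 1/2 else 0) + (if a = j \<and> b = i then 1/2 else 0)), 0)"

definition dV :: "'m::finite \<Rightarrow> 'n::finite \<Rightarrow> ('n,'m) op" where
  "dV k l f = dderiv f (0, (\<chi> a b. if a = k \<and> b = l then 1 else 0))"

definition M2Y :: "'n::finite \<Rightarrow> 'n \<Rightarrow> ('n,'m::finite) op" where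
  "M2Y i k f = (\<lambda>x. \<Sum>l\<in>UNIV. 2 * (fst x $ i $ l) * dY l k f x)"

fun M2Ypow :: "nat \<Rightarrow> 'n::finite \<Rightarrow> 'n \<Rightarrow> ('n,'m::finite) op" where
  "M2Ypow 0 i k f = (if i = k then f else (\<lambda>x. 0))"
| "M2Ypow (Suc j) i k f = (\<lambda>x. \<Sum>l\<in>UNIV. M2Y i l (M2Ypow j l k f) x)"

definition Dop :: "nat \<Rightarrow> ('n::finite,'m::finite) op" where
  "Dop j f = (\<lambda>x. \<Sum>i\<in>UNIV. M2Ypow j i i f x)"

definition Omega0 :: "'m::finite \<Rightarrow> 'm \<Rightarrow> ('n::finite,'m) op" where
  "Omega0 p q f = (\<lambda>x. \<Sum>a\<in>UNIV. \<Sum>b\<in>UNIV. (fst x $ a $ b) * dV p a (dV q b f) x)"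

end

theory Submission
  imports Defs
begin

text \<open>
  At a symmetric \<open>Y\<close> the entries \<open>E\<^sub>i\<^sub>j\<close> of \<open>2Y \<partial>/\<partial>Y\<close> are vector fields tangent to the symmetric
  matrices: they are the fundamental fields of the action \<open>Y \<mapsto> A Y A\<^sup>T\<close> and satisfy
  \<open>[E\<^sub>i\<^sub>j, E\<^sub>k\<^sub>l] = \<delta>\<^sub>j\<^sub>k E\<^sub>i\<^sub>l - \<delta>\<^sub>i\<^sub>l E\<^sub>k\<^sub>j\<close>. By induction \<open>[E\<^sub>i\<^sub>j, (E\<^sup>s)\<^sub>k\<^sub>l]\<close> has the same shape, so that
  \<open>D\<^sub>s = Tr (E\<^sup>s)\<close> commutes with every \<open>E\<^sub>i\<^sub>j\<close>, hence with every \<open>D\<^sub>r\<close>. Since functions on a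
  neighbourhood of \<open>Pnm\<close> also live at non-symmetric \<open>Y\<close>, where these relations fail, identities
  are only propagated on \<open>Pnm\<close>; tangency makes the \<open>E\<^sub>i\<^sub>j\<close> respect equality on \<open>Pnm\<close>.
  The operators \<open>\<Omega>\<^sub>p\<^sub>q\<close> have coefficients independent of \<open>V\<close>, so they commute, and
  \<open>D\<^sub>1\<close> is twice the Euler operator in \<open>Y\<close>, for which \<open>\<Omega>\<^sub>p\<^sub>q\<close> is homogeneous of degree one.
\<close>

section \<open>Directional derivatives and smooth functions\<close>

lemma has_derivative_dderiv:
  assumes "f differentiable (at x)"
  shows "(f has_derivative (\<lambda>d. dderiv f d x)) (at x)"
  using assms by (simp add: dderiv_def[abs_def] frechet_derivative_works[symmetric])

lemma dderiv_eqI: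
  assumes "(f has_derivative f') (at x)"
  shows "dderiv f d x = f' d"
  using frechet_derivative_at[OF assms] by (simp add: dderiv_def)

text \<open>\<open>frechet_derivative\<close> is a choice among candidate derivatives, so it
  suffices that \<open>f\<close> and \<open>g\<close> have the same candidates at \<open>x\<close>;
  this also covers points where they are not differentiable.\<close>

lemma dderiv_cong_open:
  assumes "open U" "x \<in> U" "\<And>y. y \<in> U \<Longrightarrow> f y = g y"
  shows "dderiv f d x = dderiv g d x"
proof -
  have "(f has_derivative F) (at x) \<longleftrightarrow> (g has_derivative F) (at x)" for F
    using assms has_derivative_transform_within_open[of f F x UNIV U g]
      has_derivative_transform_within_open[of g F x UNIV U f] by auto
  then show ?thesis by (simp add: dderiv_def frechet_derivative_def)
qed

text \<open>The chain rule along an affine line; it reduces later arguments to the one-variable mean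
  value theorem and to local constancy.\<close>

lemma DERIV_along_line:
  assumes "f differentiable (at (x + s *\<^sub>R d))"
  shows "((\<lambda>t. f (x + t *\<^sub>R d)) has_field_derivative dderiv f d (x + s *\<^sub>R d)) (at s within S)"
proof -
  let ?F = "\<lambda>v. dderiv f v (x + s *\<^sub>R d)"
  have F: "(f has_derivative ?F) (at (x + s *\<^sub>R d))"
    using assms by (rule has_derivative_dderiv)
  have "((\<lambda>t. x + t *\<^sub>R d) has_derivative (\<lambda>h. h *\<^sub>R d)) (at s within S)"
    by (auto intro!: derivative_eq_intros)
  from diff_chain_within[OF this has_derivative_at_withinI[OF F]]
  have "((\<lambda>t. f (x + t *\<^sub>R d)) has_derivative (\<lambda>h. ?F (h *\<^sub>R d))) (at s within S)"
    by (simp add: o_def)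
  moreover have "?F (h *\<^sub>R d) = ?F d * h" for h
    using linear_scale[OF has_derivative_linear[OF F]] by simp
  ultimately show ?thesis by (simp add: has_field_derivative_def)
qed

text \<open>The rules for sums and products determine \<open>dderiv\<close> only at points of
  \<open>U\<close>, so the inductions on \<open>k\<close> need to replace a function by one equal to
  it on \<open>U\<close>.\<close>

lemma Ck_cong:
  assumes "open U"
  shows "Ck k U f \<Longrightarrow> (\<And>y. y \<in> U \<Longrightarrow> f y = g y) \<Longrightarrow> Ck k U g"
proof (induction k arbitrary: f g)
  case 0
  then show ?case by (simp cong: continuous_on_cong)
next
  case (Suc k)
  have "g differentiable_on U"
    unfolding differentiable_on_def
  proof
    fix x assume x: "x \<in> U"
    with Suc.prems(1) have "f differentiable (at x within U)"
      by (simp add: differentiable_on_def)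
    then show "g differentiable (at x within U)"
      by (rule differentiable_transform_within[OF _ zero_less_one x]) (use Suc.prems(2) in simp)
  qed
  moreover have "continuous_on U g"
    using Suc.prems by (simp cong: continuous_on_cong)
  moreover have "Ck k U (dderiv g d)" for d
  proof (rule Suc.IH)
    show "Ck k U (dderiv f d)" using Suc.prems(1) by simp
    show "dderiv f d y = dderiv g d y" if "y \<in> U" for y
      using Suc.prems(2) by (rule dderiv_cong_open[OF assms that])
  qed
  ultimately show ?case by simp
qed

lemma Ck_SucD: "open U \<Longrightarrow> Ck (Suc k) U f \<Longrightarrow> Ck k U f"
  by (induction k arbitrary: f) auto

lemma Ck_Suc_differentiable_at: "open U \<Longrightarrow> Ck (Suc k) U f \<Longrightarrow> x \<in> U \<Longrightarrow> f differentiable (at x)"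
  by (simp add: differentiable_on_eq_differentiable_at)

lemma smooth_on_differentiable_at:
  assumes "open U" "smooth_on U f" "x \<in> U"
  shows "f differentiable (at x)"
  using assms by (intro Ck_Suc_differentiable_at[of U 0]) (auto simp: smooth_on_def simp del: Ck.simps)

lemma smooth_on_continuous_on: "smooth_on U f \<Longrightarrow> continuous_on U f"
  unfolding smooth_on_def by (metis Ck.simps(1))

lemma smooth_on_dderiv: "smooth_on U f \<Longrightarrow> smooth_on U (dderiv f d)"
  unfolding smooth_on_def by (metis Ck.simps(2))

lemma dderiv_const [simp]: "dderiv (\<lambda>x. c) d = (\<lambda>x. 0)"
  by (simp add: dderiv_def[abs_def])

lemma dderiv_bounded_linear: "bounded_linear f \<Longrightarrow> dderiv f d x = f d"
  by (rule dderiv_eqI[OF bounded_linear_imp_has_derivative])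

lemma dderiv_add_at:
  assumes "f differentiable (at x)" "g differentiable (at x)"
  shows "dderiv (\<lambda>y. f y + g y) d x = dderiv f d x + dderiv g d x"
  using has_derivative_add[OF assms[THEN has_derivative_dderiv]] by (rule dderiv_eqI)

lemma dderiv_mult_at:
  fixes f g :: "'a::real_normed_vector \<Rightarrow> real"
  assumes "f differentiable (at x)" "g differentiable (at x)"
  shows "dderiv (\<lambda>y. f y * g y) d x = f x * dderiv g d x + dderiv f d x * g x"
  using has_derivative_mult[OF assms[THEN has_derivative_dderiv]] by (rule dderiv_eqI)

section \<open>Closure of smooth functions under sums and products\<close>

lemma Ck_const: "Ck k U (\<lambda>x. c)"
  by (induction k arbitrary: c) auto

lemma Ck_add:
  assumes "open U"
  shows "Ck k U f \<Longrightarrow> Ck k U g \<Longrightarrow> Ck k U (\<lambda>x. f x + g x)"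
proof (induction k arbitrary: f g)
  case 0
  then show ?case by (auto intro: continuous_intros)
next
  case (Suc k)
  have "Ck k U (dderiv (\<lambda>x. f x + g x) d)" for d
  proof (rule Ck_cong[OF assms])
    show "Ck k U (\<lambda>x. dderiv f d x + dderiv g d x)"
      using Suc by auto
  qed (rule dderiv_add_at[OF Ck_Suc_differentiable_at[OF assms Suc.prems(1)]
        Ck_Suc_differentiable_at[OF assms Suc.prems(2)], symmetric])
  then show ?case
    using Suc.prems by (auto intro: continuous_intros differentiable_on_add)
qed

lemma Ck_mult:
  assumes "open U"
  shows "Ck k U f \<Longrightarrow> Ck k U g \<Longrightarrow> Ck k U (\<lambda>x. f x * g x)"
proof (induction k arbitrary: f g)
  case 0
  then show ?case by (auto intro: continuous_intros)
next
  case (Suc k)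
  have "Ck k U (dderiv (\<lambda>x. f x * g x) d)" for d
  proof (rule Ck_cong[OF assms])
    show "Ck k U (\<lambda>x. f x * dderiv g d x + dderiv f d x * g x)"
      \<comment> \<open>The product rule keeps one factor underived, which must be lowered to order
        \<open>k\<close> before the induction hypothesis applies.\<close>
      using Suc.prems Ck_SucD[OF assms Suc.prems(1)] Ck_SucD[OF assms Suc.prems(2)]
      by (intro Ck_add[OF assms] Suc.IH) auto
  qed (rule dderiv_mult_at[OF Ck_Suc_differentiable_at[OF assms Suc.prems(1)]
        Ck_Suc_differentiable_at[OF assms Suc.prems(2)], symmetric])
  then show ?case
    using Suc.prems by (auto intro: continuous_intros differentiable_on_mult)
qed

lemma Ck_bounded_linear:
  assumes "bounded_linear f"
  shows "Ck k U f"
proof (cases k)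
  case 0
  then show ?thesis using assms by (simp add: linear_continuous_on)
next
  case (Suc k')
  have "dderiv f d = (\<lambda>x. f d)" for d
    using dderiv_bounded_linear[OF assms] by auto
  then show ?thesis
    using Suc assms Ck_const bounded_linear_imp_differentiable_on linear_continuous_on by auto
qed

lemma smooth_on_const: "smooth_on U (\<lambda>x. c)"
  by (simp add: smooth_on_def Ck_const)

lemma smooth_on_bounded_linear: "bounded_linear f \<Longrightarrow> smooth_on U f"
  by (simp add: smooth_on_def Ck_bounded_linear)

lemma smooth_on_add:
  "open U \<Longrightarrow> smooth_on U f \<Longrightarrow> smooth_on U g \<Longrightarrow> smooth_on U (\<lambda>x. f x + g x)"
  by (simp add: smooth_on_def Ck_add)

lemma smooth_on_mult:
  "open U \<Longrightarrow> smooth_on U f \<Longrightarrow> smooth_on U g \<Longrightarrow> smooth_on U (\<lambda>x. f x * g x)"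
  by (simp add: smooth_on_def Ck_mult)

lemma smooth_on_sum:
  assumes "open U" "\<And>a. a \<in> A \<Longrightarrow> smooth_on U (g a)"
  shows "smooth_on U (\<lambda>x. \<Sum>a\<in>A. g a x)"
  using assms(2) by (induction A rule: infinite_finite_induct)
    (auto intro: smooth_on_const smooth_on_add[OF assms(1)])

lemma dderiv_sum:
  assumes "open U" "\<And>a. a \<in> A \<Longrightarrow> smooth_on U (g a)" "x \<in> U"
  shows "dderiv (\<lambda>y. \<Sum>a\<in>A. g a y) d x = (\<Sum>a\<in>A. dderiv (g a) d x)"
proof (rule dderiv_eqI[of _ "\<lambda>d. \<Sum>a\<in>A. dderiv (g a) d x"], rule has_derivative_sum)
  show "(g a has_derivative (\<lambda>d. dderiv (g a) d x)) (at x)" if "a \<in> A" for a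
    using assms that by (intro has_derivative_dderiv smooth_on_differentiable_at)
qed

lemma dderiv_mult:
  assumes "open U" "smooth_on U f" "smooth_on U g" "x \<in> U"
  shows "dderiv (\<lambda>y. f y * g y) d x = f x * dderiv g d x + dderiv f d x * g x"
  using assms by (intro dderiv_mult_at smooth_on_differentiable_at[of U])

subsection \<open>Symmetry of second derivatives\<close>

text \<open>Two mean value steps: first along \<open>d\<close> for the difference of
  \<open>f\<close> over the step \<open>t *\<^sub>R e\<close>, then along \<open>e\<close> for
  \<open>dderiv f d\<close>. The second difference on the left is symmetric in \<open>d\<close> and
  \<open>e\<close>.\<close>

lemma second_difference_mean_value:
  assumes "t > 0"
    and U: "\<And>s r. 0 \<le> s \<Longrightarrow> s \<le> t \<Longrightarrow> 0 \<le> r \<Longrightarrow> r \<le> t \<Longrightarrow> x + s *\<^sub>R d + r *\<^sub>R e \<in> U"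
    and f: "\<And>y. y \<in> U \<Longrightarrow> f differentiable (at y)"
    and f': "\<And>y. y \<in> U \<Longrightarrow> dderiv f d differentiable (at y)"
  obtains s r where "0 < s" "s < t" "0 < r" "r < t"
    "f (x + t *\<^sub>R d + t *\<^sub>R e) - f (x + t *\<^sub>R d) - f (x + t *\<^sub>R e) + f x
      = t\<^sup>2 * dderiv (dderiv f d) e (x + s *\<^sub>R d + r *\<^sub>R e)"
proof -
  define g where "g s = f (x + t *\<^sub>R e + s *\<^sub>R d) - f (x + s *\<^sub>R d)" for s
  define g' where "g' s = dderiv f d (x + t *\<^sub>R e + s *\<^sub>R d) - dderiv f d (x + s *\<^sub>R d)" for s
  have "DERIV g s :> g' s" if "0 \<le> s" "s \<le> t" for s
    unfolding g_def g'_def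
    using f U[of s 0] U[of s t] that \<open>t > 0\<close>
    by (intro DERIV_diff DERIV_along_line) (auto simp: algebra_simps)
  from MVT2[OF \<open>t > 0\<close> this] obtain s where s: "0 < s" "s < t" "g t - g 0 = t * g' s"
    by auto
  define h where "h r = dderiv f d (x + s *\<^sub>R d + r *\<^sub>R e)" for r
  have "DERIV h r :> dderiv (dderiv f d) e (x + s *\<^sub>R d + r *\<^sub>R e)" if "0 \<le> r" "r \<le> t" for r
    unfolding h_def using f' U[of s r] that s by (intro DERIV_along_line) auto
  from MVT2[OF \<open>t > 0\<close> this] obtain r where r: "0 < r" "r < t"
    "h t - h 0 = t * dderiv (dderiv f d) e (x + s *\<^sub>R d + r *\<^sub>R e)"
    by auto
  have "g' s = h t - h 0"
    by (simp add: g'_def h_def algebra_simps)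
  with s r have "g t - g 0 = t\<^sup>2 * dderiv (dderiv f d) e (x + s *\<^sub>R d + r *\<^sub>R e)"
    by (simp add: power2_eq_square)
  then show ?thesis
    using that s r by (simp add: g_def algebra_simps)
qed

text \<open>Schwarz's theorem: the same second difference computed in both orders makes the two
  mixed derivatives agree at some pair of points arbitrarily close to \<open>x\<close>, and
  continuity carries this to \<open>x\<close>.\<close>

lemma dderiv_commute:
  assumes U: "open U" and f: "smooth_on U f" and x: "x \<in> U"
  shows "dderiv (dderiv f d) e x = dderiv (dderiv f e) d x"
proof -
  let ?A = "dderiv (dderiv f d) e" and ?B = "dderiv (dderiv f e) d"
  have "isCont (dderiv (dderiv f v) w) x" for v w
    using smooth_on_continuous_on[OF smooth_on_dderiv[OF smooth_on_dderiv[OF f]], of v w] x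
    by (simp add: continuous_on_eq_continuous_at[OF U])
  then have lim: "(?A \<longlongrightarrow> ?A x) (nhds x)" "(?B \<longlongrightarrow> ?B x) (nhds x)"
    by (simp_all add: continuous_at tendsto_at_iff_tendsto_nhds)
  have "\<bar>?A x - ?B x\<bar> < \<epsilon>" if "\<epsilon> > 0" for \<epsilon>
  proof -
    have "\<forall>\<^sub>F y in nhds x. y \<in> U \<and> dist (?A y) (?A x) < \<epsilon>/2 \<and> dist (?B y) (?B x) < \<epsilon>/2"
      using that U x by (intro eventually_conj tendstoD[OF lim(1)] tendstoD[OF lim(2)])
        (auto intro: eventually_nhds_in_open)
    then obtain \<delta> where \<delta>: "\<delta> > 0" "\<And>y. dist y x < \<delta> \<Longrightarrow>
        y \<in> U \<and> dist (?A y) (?A x) < \<epsilon>/2 \<and> dist (?B y) (?B x) < \<epsilon>/2"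
      unfolding eventually_nhds_metric by auto
    \<comment> \<open>This size keeps the whole parallelogram within \<delta> of \<open>x\<close>;
      the summand 1 avoids division by zero when \<open>d\<close> and \<open>e\<close>
      vanish.\<close>
    define t where "t = \<delta> / (1 + norm d + norm e)"
    have pos: "0 < 1 + norm d + norm e"
      by (smt (verit) norm_ge_zero)
    have t: "t > 0" unfolding t_def using \<delta>(1) pos by simp
    have near: "dist (x + s *\<^sub>R d + r *\<^sub>R e) x < \<delta>" if "0 \<le> s" "s \<le> t" "0 \<le> r" "r \<le> t" for s r
    proof -
      have "dist (x + s *\<^sub>R d + r *\<^sub>R e) x \<le> s * norm d + r * norm e"
        using norm_triangle_ineq[of "s *\<^sub>R d" "r *\<^sub>R e"] that by (simp add: dist_norm algebra_simps)
      also have "\<dots> \<le> t * norm d + t * norm e"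
        using that by (intro add_mono mult_right_mono) auto
      also have "\<dots> < t * (1 + norm d + norm e)"
        using t by (simp add: algebra_simps)
      also have "\<dots> = \<delta>" unfolding t_def using pos by simp
      finally show ?thesis .
    qed
    have diff: "f differentiable (at y)" "dderiv f v differentiable (at y)" if "y \<in> U" for v y
      using f that by (auto intro!: smooth_on_differentiable_at[OF U] smooth_on_dderiv)
    obtain s r where sr: "0 < s" "s < t" "0 < r" "r < t"
      "f (x + t *\<^sub>R d + t *\<^sub>R e) - f (x + t *\<^sub>R d) - f (x + t *\<^sub>R e) + f x
        = t\<^sup>2 * ?A (x + s *\<^sub>R d + r *\<^sub>R e)"
      by (rule second_difference_mean_value[OF t, of x d e U f]) (use diff near \<delta>(2) in auto)
    obtain s' r' where sr': "0 < s'" "s' < t" "0 < r'" "r' < t"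
      "f (x + t *\<^sub>R e + t *\<^sub>R d) - f (x + t *\<^sub>R e) - f (x + t *\<^sub>R d) + f x
        = t\<^sup>2 * ?B (x + s' *\<^sub>R e + r' *\<^sub>R d)"
    proof (rule second_difference_mean_value[OF t, of x e d U f])
      show "x + s *\<^sub>R e + r *\<^sub>R d \<in> U" if "0 \<le> s" "s \<le> t" "0 \<le> r" "r \<le> t" for s r
        using near[of r s] \<delta>(2)[of "x + s *\<^sub>R e + r *\<^sub>R d"] that by (simp add: algebra_simps)
    qed (use diff in auto)
    have "t\<^sup>2 * ?A (x + s *\<^sub>R d + r *\<^sub>R e) = t\<^sup>2 * ?B (x + r' *\<^sub>R d + s' *\<^sub>R e)"
      using sr(5) sr'(5) by (simp add: algebra_simps)
    then have "?A (x + s *\<^sub>R d + r *\<^sub>R e) = ?B (x + r' *\<^sub>R d + s' *\<^sub>R e)"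
      using t by simp
    moreover have "dist (?A (x + s *\<^sub>R d + r *\<^sub>R e)) (?A x) < \<epsilon>/2"
      using near[of s r] \<delta>(2) sr by simp
    moreover have "dist (?B (x + r' *\<^sub>R d + s' *\<^sub>R e)) (?B x) < \<epsilon>/2"
      using near[of r' s'] \<delta>(2) sr' by simp
    ultimately show ?thesis unfolding dist_real_def by linarith
  qed
  \<comment> \<open>Were the values distinct, their distance would be smaller than itself.\<close>
  from this[of "\<bar>?A x - ?B x\<bar>"] show ?thesis by (cases "?A x = ?B x") auto
qed

section \<open>The coordinate operators on \<open>\<P>\<^sub>n\<^sub>,\<^sub>m\<close>\<close>

text \<open>Moving a symmetric coordinate \<open>y_ij\<close> with i different from j moves two
  matrix entries at once; the weights 1/2 give half of that direction, and on the diagonal they add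
  up to 1.\<close>

definition symE :: "'n::finite \<Rightarrow> 'n \<Rightarrow> real^'n^'n" where
  "symE i j = (\<chi> a b. (if a = i \<and> b = j then 1/2 else 0) + (if a = j \<and> b = i then 1/2 else 0))"

lemma symE_nth: "symE i j $ a $ b = (of_bool (a = i \<and> b = j) + of_bool (a = j \<and> b = i)) / 2"
proof -
  have "(if P then 1/2 else 0) + (if Q then 1/2 else 0) = (of_bool P + of_bool Q :: real) / 2" for P Q
    by (cases P; cases Q) simp_all
  then show ?thesis unfolding symE_def vec_lambda_beta .
qed

lemma symE_commute: "symE i j = symE j i"
  unfolding vec_eq_iff symE_nth by (simp only: add.commute simp_thms)

lemma transpose_symE: "transpose (symE i j) = symE i j"
  unfolding vec_eq_iff symE_nth transpose_def vec_lambda_beta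
  by (simp only: add.commute conj_commute simp_thms)

lemma dY_eq: "dY i j f = dderiv f (symE i j, 0)"
  by (simp add: dY_def symE_def)

lemma dY_commute: "dY i j f = dY j i f"
  by (simp add: dY_eq symE_commute)

lemma bounded_linear_coordinate:
  "bounded_linear (\<lambda>x::('n::finite,'m::finite) pt. fst x $ i $ j)"
  by (rule bounded_linear_compose[OF bounded_linear_vec_nth
        bounded_linear_compose[OF bounded_linear_vec_nth bounded_linear_fst]])

lemma dY_coordinate: "dY i j (\<lambda>x. fst x $ a $ b) x = symE i j $ a $ b"
  by (simp add: dY_eq dderiv_bounded_linear[OF bounded_linear_coordinate])

text \<open>At symmetric \<open>Y\<close> these are the entries of \<open>E_ji Y + Y E_ij\<close>,
  the velocity of \<open>A Y A^T\<close> at the identity in the direction of the matrix unit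
  \<open>E_ji\<close>.\<close>

lemma M2Y_coordinate:
  "M2Y i j (\<lambda>x. fst x $ a $ b) x = fst x $ i $ a * of_bool (b = j) + fst x $ i $ b * of_bool (a = j)"
proof -
  have "M2Y i j (\<lambda>x. fst x $ a $ b) x
      = (\<Sum>l\<in>UNIV. of_bool (a = l) * (fst x $ i $ l * of_bool (b = j))
          + of_bool (b = l) * (fst x $ i $ l * of_bool (a = j)))"
    unfolding M2Y_def dY_coordinate symE_nth by (intro sum.cong) auto
  then show ?thesis
    by (simp add: sum.distrib)
qed

section \<open>Positive definiteness along symmetric directions\<close>

lemma Pnm_symmetric: "x \<in> Pnm \<Longrightarrow> fst x $ a $ b = fst x $ b $ a"
  by (auto simp: Pnm_def transpose_def vec_eq_iff)

text \<open>The constant is the minimum of the form on the compact unit sphere; homogeneity of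
  degree two extends the bound to all vectors.\<close>

lemma quadratic_form_lower_bound:
  fixes Y :: "real^'n::finite^'n"
  assumes "\<And>v. v \<noteq> 0 \<Longrightarrow> v \<bullet> (Y *v v) > 0"
  obtains c where "c > 0" "\<And>v. c * (norm v)\<^sup>2 \<le> v \<bullet> (Y *v v)"
proof -
  have "continuous_on (sphere 0 1) (\<lambda>v. v \<bullet> (Y *v v))"
    by (intro continuous_intros linear_continuous_on matrix_vector_mul_bounded_linear)
  then obtain u where u: "u \<in> sphere 0 1" "\<And>v. v \<in> sphere 0 1 \<Longrightarrow> u \<bullet> (Y *v u) \<le> v \<bullet> (Y *v v)"
    using continuous_attains_inf[of "sphere 0 1" "\<lambda>v. v \<bullet> (Y *v v)"] by auto
  have "u \<bullet> (Y *v u) * (norm v)\<^sup>2 \<le> v \<bullet> (Y *v v)" for v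
  proof (cases "v = 0")
    case False
    define w where "w = v /\<^sub>R norm v"
    have v: "v = norm v *\<^sub>R w" using False by (simp add: w_def)
    have "v \<bullet> (Y *v v) = (norm v)\<^sup>2 * (w \<bullet> (Y *v w))"
      by (subst (1 2) v) (simp add: matrix_vector_mult_scaleR power2_eq_square)
    moreover have "u \<bullet> (Y *v u) \<le> w \<bullet> (Y *v w)"
      using False by (intro u(2)) (simp add: w_def)
    ultimately show ?thesis
      by (simp add: mult.commute[of _ "(norm v)\<^sup>2"] mult_left_mono)
  qed simp
  moreover have "u \<bullet> (Y *v u) > 0"
    using u(1) by (intro assms) auto
  ultimately show ?thesis using that by blast
qed

text \<open>A small symmetric perturbation preserves both symmetry and positivity, although
  \<open>Pnm\<close> need not be open in the space of all pairs of matrices.\<close>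

lemma Pnm_open_along_symmetric:
  assumes x: "x \<in> (Pnm :: ('n::finite,'m::finite) pt set)" and D: "transpose D = D"
  obtains \<delta> where "\<delta> > 0" "\<And>t. \<bar>t\<bar> < \<delta> \<Longrightarrow> x + t *\<^sub>R (D, W) \<in> Pnm"
proof -
  obtain Y V where xYV: "x = (Y, V)" by fastforce
  with x have sym: "transpose Y = Y" and pos: "\<And>v. v \<noteq> 0 \<Longrightarrow> v \<bullet> (Y *v v) > 0"
    by (auto simp: Pnm_def)
  obtain c where c: "c > 0" "\<And>v. c * (norm v)\<^sup>2 \<le> v \<bullet> (Y *v v)"
    using quadratic_form_lower_bound[OF pos] by blast
  obtain K where K: "K > 0" "\<And>v. norm (D *v v) \<le> norm v * K"
    using bounded_linear.pos_bounded[OF matrix_vector_mul_bounded_linear] by blast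
  \<comment> \<open>Below \<open>c / K\<close> the perturbation of the quadratic form, at most
    \<open>\<bar>t\<bar> * K * (norm v)\<^sup>2\<close>, stays under the lower bound
    \<open>c * (norm v)\<^sup>2\<close>.\<close>
  have "x + t *\<^sub>R (D, W) \<in> Pnm" if t: "\<bar>t\<bar> < c / K" for t
  proof -
    have "v \<bullet> ((Y + t *\<^sub>R D) *v v) > 0" if "v \<noteq> 0" for v
    proof -
      have "\<bar>t * (v \<bullet> (D *v v))\<bar> \<le> \<bar>t\<bar> * (norm v * (norm v * K))"
        unfolding abs_mult using K(2)[of v]
        by (intro mult_left_mono order_trans[OF Cauchy_Schwarz_ineq2]) auto
      also have "\<dots> = (\<bar>t\<bar> * K) * (norm v)\<^sup>2" by (simp add: power2_eq_square)
      also have "\<dots> < c * (norm v)\<^sup>2"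
        using t K(1) that by (intro mult_strict_right_mono) (auto simp: field_simps)
      also have "\<dots> \<le> v \<bullet> (Y *v v)" by (rule c)
      finally show ?thesis
        by (simp add: matrix_vector_mult_add_rdistrib inner_add_right scaleR_matrix_vector_assoc[symmetric])
    qed
    moreover have "transpose (Y + t *\<^sub>R D) = Y + t *\<^sub>R D"
      using sym D by (simp add: transpose_def vec_eq_iff)
    ultimately show ?thesis by (simp add: Pnm_def xYV)
  qed
  with c(1) K(1) that[of "c / K"] show ?thesis by simp
qed

text \<open>A short segment in a symmetric direction stays in \<open>Pnm\<close>, and on it
  \<open>f - g\<close> vanishes identically, hence so does its derivative at
  \<open>x\<close>.\<close>

lemma dderiv_cong_Pnm:
  assumes "x \<in> (Pnm :: ('n::finite,'m::finite) pt set)" "transpose D = D"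
    and "f differentiable (at x)" "g differentiable (at x)" "\<And>y. y \<in> Pnm \<Longrightarrow> f y = g y"
  shows "dderiv f (D, W) x = dderiv g (D, W) x"
proof -
  obtain \<delta> where \<delta>: "\<delta> > 0" "\<And>t. \<bar>t\<bar> < \<delta> \<Longrightarrow> x + t *\<^sub>R (D, W) \<in> Pnm"
    using Pnm_open_along_symmetric assms(1,2) by blast
  define w where "w = (D, W)"
  have "DERIV (\<lambda>t. f (x + t *\<^sub>R w) - g (x + t *\<^sub>R w)) 0 :> dderiv f w x - dderiv g w x"
    using DERIV_diff[OF DERIV_along_line[of f x 0 w] DERIV_along_line[of g x 0 w]] assms(3,4)
    by simp
  moreover have "\<forall>t. \<bar>0 - t\<bar> < \<delta> \<longrightarrow>
      f (x + 0 *\<^sub>R w) - g (x + 0 *\<^sub>R w) = f (x + t *\<^sub>R w) - g (x + t *\<^sub>R w)"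
    using \<delta>(2) assms(1,5) by (simp add: w_def del: scaleR_Pair)
  ultimately have "dderiv f w x - dderiv g w x = 0"
    using \<delta>(1) by (blast intro: DERIV_local_const)
  then show ?thesis by (simp add: w_def)
qed

text \<open>Derivatives are taken in the space of all square matrices, where \<open>Pnm\<close> has
  empty interior once n > 1; test functions therefore live on an open set around it.\<close>

locale Pnm_neighbourhood =
  fixes U :: "('n::finite,'m::finite) pt set"
  assumes openU: "open U" and Pnm_subset: "Pnm \<subseteq> U"
begin

section \<open>Smoothness and Leibniz rules for the operators\<close>

lemma PnmD: "x \<in> Pnm \<Longrightarrow> x \<in> U"
  using Pnm_subset by blast

lemma smooth_coordinate: "smooth_on U (\<lambda>x. fst x $ i $ j)"
  by (rule smooth_on_bounded_linear[OF bounded_linear_coordinate])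

lemma smooth_dY: "smooth_on U f \<Longrightarrow> smooth_on U (dY i j f)"
  unfolding dY_eq by (rule smooth_on_dderiv)

lemma smooth_dV: "smooth_on U f \<Longrightarrow> smooth_on U (dV i j f)"
  unfolding dV_def by (rule smooth_on_dderiv)

lemma smooth_M2Y: "smooth_on U f \<Longrightarrow> smooth_on U (M2Y i j f)"
  unfolding M2Y_def
  by (intro smooth_on_sum smooth_on_mult smooth_on_const smooth_coordinate smooth_dY openU)

lemma smooth_M2Ypow: "smooth_on U f \<Longrightarrow> smooth_on U (M2Ypow s i j f)"
  by (induction s arbitrary: i j)
    (auto intro!: smooth_on_const smooth_on_sum smooth_M2Y openU)

lemma smooth_Dop: "smooth_on U f \<Longrightarrow> smooth_on U (Dop s f)"
  unfolding Dop_def by (intro smooth_on_sum smooth_M2Ypow openU)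

lemma M2Y_sum:
  assumes "\<And>a. a \<in> A \<Longrightarrow> smooth_on U (g a)" "x \<in> U"
  shows "M2Y i j (\<lambda>y. \<Sum>a\<in>A. g a y) x = (\<Sum>a\<in>A. M2Y i j (g a) x)"
  unfolding M2Y_def dY_eq
  by (simp add: dderiv_sum[OF openU assms] sum_distrib_left sum.swap[of _ A])

lemma M2Y_mult:
  assumes "smooth_on U f" "smooth_on U g" "x \<in> U"
  shows "M2Y i j (\<lambda>y. f y * g y) x = f x * M2Y i j g x + M2Y i j f x * g x"
  unfolding M2Y_def dY_eq
  by (simp add: dderiv_mult[OF openU assms] sum_distrib_left sum_distrib_right
      sum.distrib[symmetric] algebra_simps)

lemma M2Y_const: "M2Y i j (\<lambda>x. c) x = 0"
  by (simp add: M2Y_def dY_eq)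

lemma M2Y_linear_combination:
  assumes "smooth_on U f" "smooth_on U g" "smooth_on U h" "x \<in> U"
  shows "M2Y i j (\<lambda>y. f y + a * g y - b * h y) x
    = M2Y i j f x + a * M2Y i j g x - b * M2Y i j h x"
proof -
  have d: "f differentiable (at x)" "g differentiable (at x)" "h differentiable (at x)"
    using assms smooth_on_differentiable_at[OF openU] by auto
  have "dderiv (\<lambda>y. f y + a * g y - b * h y) v x = dderiv f v x + a * dderiv g v x - b * dderiv h v x" for v
    by (rule dderiv_eqI) (intro derivative_intros has_derivative_dderiv d)
  then show ?thesis
    unfolding M2Y_def dY_eq
    by (simp add: sum_distrib_left sum.distrib[symmetric] sum_subtractf[symmetric] right_diff_distrib
        distrib_left ac_simps)
qed

text \<open>All directions \<open>symE\<close> are symmetric, so identities known only on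
  \<open>Pnm\<close> may be differentiated by \<open>M2Y\<close>.\<close>

lemma M2Y_cong:
  assumes "smooth_on U f" "smooth_on U g" "\<And>y. y \<in> Pnm \<Longrightarrow> f y = g y" "x \<in> Pnm"
  shows "M2Y i j f x = M2Y i j g x"
  unfolding M2Y_def dY_eq
  using dderiv_cong_Pnm[OF assms(4) transpose_symE] assms smooth_on_differentiable_at[OF openU] PnmD
  by (intro sum.cong) auto

section \<open>The Gelfand invariants\<close>

text \<open>The middle term \<open>2 y\<^sub>i\<^sub>k (\<partial>/\<partial>Y)\<^sub>j\<^sub>l\<close> cancels in the commutator only where \<open>y\<^sub>i\<^sub>k = y\<^sub>k\<^sub>i\<close>.\<close>

lemma M2Y_M2Y:
  assumes f: "smooth_on U f" and x: "x \<in> U"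
  shows "M2Y i j (M2Y k l f) x = of_bool (j = k) * M2Y i l f x + 2 * fst x $ i $ k * dY j l f x
    + (\<Sum>a\<in>UNIV. \<Sum>b\<in>UNIV. 4 * fst x $ i $ a * fst x $ k $ b * dY a j (dY b l f) x)"
proof -
  have "M2Y i j (M2Y k l f) x = (\<Sum>b\<in>UNIV. M2Y i j (\<lambda>x. 2 * fst x $ k $ b * dY b l f x) x)"
    unfolding M2Y_def[of k l f]
    by (intro M2Y_sum smooth_on_mult smooth_on_const smooth_coordinate smooth_dY openU f x)
  \<comment> \<open>Differentiating the coefficient \<open>y_kb\<close> yields two Kronecker terms:
    one becomes the middle term, the other the \<open>M2Y i l\<close> term.\<close>
  also have "\<dots> = (\<Sum>b\<in>UNIV. 2 * fst x $ k $ b * M2Y i j (dY b l f) x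
      + 2 * (fst x $ i $ k * of_bool (b = j) + fst x $ i $ b * of_bool (k = j)) * dY b l f x)"
    by (intro sum.cong refl)
      (simp add: M2Y_mult M2Y_const M2Y_coordinate smooth_on_mult smooth_on_const smooth_coordinate
        smooth_dY openU f x)
  also have "\<dots> = (\<Sum>b\<in>UNIV. 2 * fst x $ k $ b * M2Y i j (dY b l f) x)
      + (\<Sum>b\<in>UNIV. of_bool (j = b) * (2 * fst x $ i $ k * dY b l f x))
      + of_bool (j = k) * (\<Sum>b\<in>UNIV. 2 * fst x $ i $ b * dY b l f x)"
    unfolding sum_distrib_left sum.distrib[symmetric] by (intro sum.cong refl) auto
  also have "(\<Sum>b\<in>UNIV. of_bool (j = b) * (2 * fst x $ i $ k * dY b l f x)) = 2 * fst x $ i $ k * dY j l f x"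
    by simp
  also have "(\<Sum>b\<in>UNIV. 2 * fst x $ k $ b * M2Y i j (dY b l f) x)
      = (\<Sum>a\<in>UNIV. \<Sum>b\<in>UNIV. 4 * fst x $ i $ a * fst x $ k $ b * dY a j (dY b l f) x)"
    by (subst sum.swap) (simp add: M2Y_def sum_distrib_left algebra_simps)
  finally show ?thesis
    by (simp add: M2Y_def)
qed

text \<open>The second-order parts of the two products agree by symmetry of second derivatives and
  the middle terms by symmetry of \<open>Y\<close>; only the Kronecker terms survive.\<close>

lemma M2Y_commutator:
  assumes f: "smooth_on U f" and x: "x \<in> Pnm"
  shows "M2Y i j (M2Y k l f) x
    = M2Y k l (M2Y i j f) x + of_bool (j = k) * M2Y i l f x - of_bool (i = l) * M2Y k j f x"
proof -
  have "dY b l (dY a j f) x = dY a j (dY b l f) x" for a b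
    unfolding dY_eq by (rule dderiv_commute[OF openU f PnmD[OF x]])
  then have "(\<Sum>a\<in>UNIV. \<Sum>b\<in>UNIV. 4 * fst x $ k $ a * fst x $ i $ b * dY a l (dY b j f) x)
     = (\<Sum>a\<in>UNIV. \<Sum>b\<in>UNIV. 4 * fst x $ i $ a * fst x $ k $ b * dY a j (dY b l f) x)"
    by (subst sum.swap) (simp add: algebra_simps)
  moreover have "fst x $ k $ i * dY l j f x = fst x $ i $ k * dY j l f x"
    using Pnm_symmetric[OF x] by (simp add: dY_commute[of l j])
  ultimately show ?thesis
    using M2Y_M2Y[OF f PnmD[OF x], of i j k l] M2Y_M2Y[OF f PnmD[OF x], of k l i j] by auto
qed

lemma M2Ypow_sum:
  assumes "\<And>a. a \<in> A \<Longrightarrow> smooth_on U (g a)" "x \<in> Pnm"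
  shows "M2Ypow s k l (\<lambda>y. \<Sum>a\<in>A. g a y) x = (\<Sum>a\<in>A. M2Ypow s k l (g a) x)"
  using assms(2)
proof (induction s arbitrary: k l x)
  case (Suc s)
  have "M2Y k b (M2Ypow s b l (\<lambda>y. \<Sum>a\<in>A. g a y)) x = (\<Sum>a\<in>A. M2Y k b (M2Ypow s b l (g a)) x)" for b
  proof -
    have "M2Y k b (M2Ypow s b l (\<lambda>y. \<Sum>a\<in>A. g a y)) x = M2Y k b (\<lambda>y. \<Sum>a\<in>A. M2Ypow s b l (g a) y) x"
      using Suc assms(1) by (intro M2Y_cong smooth_M2Ypow smooth_on_sum openU)
    also have "\<dots> = (\<Sum>a\<in>A. M2Y k b (M2Ypow s b l (g a)) x)"
      using Suc assms(1) PnmD by (intro M2Y_sum smooth_M2Ypow)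
    finally show ?thesis .
  qed
  then show ?case by (simp add: sum.swap[of _ A])
qed auto

lemma Dop_sum:
  assumes "\<And>a. a \<in> A \<Longrightarrow> smooth_on U (g a)" "x \<in> Pnm"
  shows "Dop s (\<lambda>y. \<Sum>a\<in>A. g a y) x = (\<Sum>a\<in>A. Dop s (g a) x)"
  by (simp add: Dop_def M2Ypow_sum[OF assms] sum.swap[of _ A])

text \<open>Induction on \<open>s\<close>: the outer factor is passed by
  \<open>M2Y_commutator\<close>, the remaining power by the induction hypothesis, differentiated
  through \<open>M2Y_cong\<close>.\<close>

lemma M2Y_M2Ypow_commutator:
  assumes f: "smooth_on U f" and "x \<in> Pnm"
  shows "M2Y i j (M2Ypow s k l f) x = M2Ypow s k l (M2Y i j f) x
    + of_bool (j = k) * M2Ypow s i l f x - of_bool (i = l) * M2Ypow s k j f x"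
  using assms(2)
proof (induction s arbitrary: k l x)
  case 0
  then show ?case by (auto simp: M2Y_const)
next
  case (Suc s)
  have x: "x \<in> U" using Suc.prems PnmD by blast
  let ?P = "M2Ypow s"
  have step: "M2Y i j (M2Y k a (?P a l f)) x
      = M2Y k a (?P a l (M2Y i j f)) x + of_bool (j = a) * M2Y k a (?P i l f) x
        - of_bool (i = l) * M2Y k a (?P a j f) x
        + of_bool (j = k) * M2Y i a (?P a l f) x - of_bool (i = a) * M2Y k j (?P a l f) x" for a
  proof -
    have "M2Y k a (M2Y i j (?P a l f)) x = M2Y k a (\<lambda>y. ?P a l (M2Y i j f) y
        + of_bool (j = a) * ?P i l f y - of_bool (i = l) * ?P a j f y) x"
    proof (rule M2Y_cong)
      show "smooth_on U (\<lambda>y. ?P a l (M2Y i j f) y + of_bool (j = a) * ?P i l f y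
          - of_bool (i = l) * ?P a j f y)"
        unfolding diff_conv_add_uminus minus_mult_left
        by (intro smooth_on_add smooth_on_mult smooth_on_const smooth_M2Ypow smooth_M2Y f openU)
    qed (use Suc f smooth_M2Y smooth_M2Ypow in auto)
    also have "\<dots> = M2Y k a (?P a l (M2Y i j f)) x + of_bool (j = a) * M2Y k a (?P i l f) x
        - of_bool (i = l) * M2Y k a (?P a j f) x"
      by (intro M2Y_linear_combination smooth_M2Ypow smooth_M2Y f x)
    finally show ?thesis
      using M2Y_commutator[OF smooth_M2Ypow[OF f] Suc.prems, of i j k a s a l] by simp
  qed
  have "M2Y i j (M2Ypow (Suc s) k l f) x = (\<Sum>a\<in>UNIV. M2Y i j (M2Y k a (?P a l f)) x)"
    unfolding M2Ypow.simps by (intro M2Y_sum smooth_M2Y smooth_M2Ypow f x)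
  \<comment> \<open>Summed over \<open>a\<close>, the terms with \<open>j = a\<close> and
    \<open>i = a\<close> both give \<open>M2Y k j (M2Ypow s i l f) x\<close>, with opposite signs,
    and cancel.\<close>
  also have "\<dots> = M2Ypow (Suc s) k l (M2Y i j f) x
      + of_bool (j = k) * M2Ypow (Suc s) i l f x - of_bool (i = l) * M2Ypow (Suc s) k j f x"
    by (simp add: step sum.distrib sum_subtractf sum_distrib_left[symmetric])
  finally show ?case .
qed

text \<open>In the trace both correction terms sum to \<open>M2Ypow s i j f x\<close> and
  cancel.\<close>

lemma M2Y_Dop_commute:
  assumes "smooth_on U f" "x \<in> Pnm"
  shows "M2Y i j (Dop s f) x = Dop s (M2Y i j f) x"
proof -
  have "M2Y i j (Dop s f) x = (\<Sum>k\<in>UNIV. M2Y i j (M2Ypow s k k f) x)"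
    unfolding Dop_def using assms PnmD by (intro M2Y_sum smooth_M2Ypow)
  also have "\<dots> = Dop s (M2Y i j f) x"
    by (simp add: M2Y_M2Ypow_commutator[OF assms] Dop_def sum.distrib sum_subtractf)
  finally show ?thesis .
qed

text \<open>\<open>Dop s\<close> commutes with each factor \<open>M2Y\<close>, so it is moved past
  the power one factor at a time.\<close>

lemma M2Ypow_Dop_commute:
  assumes f: "smooth_on U f" and "x \<in> Pnm"
  shows "M2Ypow r k l (Dop s f) x = Dop s (M2Ypow r k l f) x"
  using assms(2)
proof (induction r arbitrary: k l x)
  case 0
  \<comment> \<open>The off-diagonal entries of the zeroth power are zero functions; the zero
    function is an empty sum.\<close>
  have "Dop s (\<lambda>x. 0) x = 0"
    using Dop_sum[of "{}" "\<lambda>_ _. 0" x s] 0 by simp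
  then show ?case by simp
next
  case (Suc r)
  have "M2Y k a (M2Ypow r a l (Dop s f)) x = Dop s (M2Y k a (M2Ypow r a l f)) x" for a
  proof -
    have "M2Y k a (M2Ypow r a l (Dop s f)) x = M2Y k a (Dop s (M2Ypow r a l f)) x"
      using Suc by (intro M2Y_cong smooth_M2Ypow smooth_Dop f)
    also have "\<dots> = Dop s (M2Y k a (M2Ypow r a l f)) x"
      by (intro M2Y_Dop_commute smooth_M2Ypow f Suc.prems)
    finally show ?thesis .
  qed
  then show ?case
    using Dop_sum[of UNIV "\<lambda>a. M2Y k a (M2Ypow r a l f)" x s] Suc.prems f
    by (simp add: smooth_M2Y smooth_M2Ypow)
qed

lemma Dop_Dop_commute:
  assumes "smooth_on U f" "x \<in> Pnm"
  shows "Dop r (Dop s f) x = Dop s (Dop r f) x"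
proof -
  have "Dop r (Dop s f) x = (\<Sum>k\<in>UNIV. Dop s (M2Ypow r k k f) x)"
    unfolding Dop_def[of r] by (simp add: M2Ypow_Dop_commute[OF assms])
  also have "\<dots> = Dop s (Dop r f) x"
    unfolding Dop_def[of r] using assms by (intro Dop_sum[symmetric] smooth_M2Ypow)
  finally show ?thesis .
qed

section \<open>The operators \<open>\<Omega>\<^sub>p\<^sub>q\<close>\<close>

text \<open>The identities among \<open>dV\<close> and \<open>Omega0\<close> hold on all of the open
  set \<open>U\<close>, so tangency plays no part in differentiating them.\<close>

lemma dV_cong:
  assumes "\<And>y. y \<in> U \<Longrightarrow> f y = g y" "x \<in> U"
  shows "dV k l f x = dV k l g x"
  unfolding dV_def using assms by (intro dderiv_cong_open[OF openU])

lemma dV_sum: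
  assumes "\<And>a. a \<in> A \<Longrightarrow> smooth_on U (g a)" "x \<in> U"
  shows "dV k l (\<lambda>y. \<Sum>a\<in>A. g a y) x = (\<Sum>a\<in>A. dV k l (g a) x)"
  unfolding dV_def by (rule dderiv_sum[OF openU assms])

lemma dV_coordinate_mult:
  assumes "smooth_on U f" "x \<in> U"
  shows "dV k l (\<lambda>y. fst y $ a $ b * f y) x = fst x $ a $ b * dV k l f x"
  unfolding dV_def dderiv_mult[OF openU smooth_coordinate assms]
  by (simp add: dderiv_bounded_linear[OF bounded_linear_coordinate])

lemma dV_dV_commute:
  assumes "smooth_on U f" "x \<in> U"
  shows "dV k l (dV p q f) x = dV p q (dV k l f) x"
  unfolding dV_def by (rule dderiv_commute[OF openU assms])

text \<open>The coefficients \<open>y_ab\<close> are constant in \<open>V\<close>, so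
  \<open>dV\<close> passes them and then permutes with the inner derivatives.\<close>

lemma dV_Omega0_commute:
  assumes f: "smooth_on U f" and x: "x \<in> U"
  shows "dV k c (Omega0 p q f) x = Omega0 p q (dV k c f) x"
proof -
  have "dV k c (dV p a (dV q b f)) x = dV p a (dV q b (dV k c f)) x" for a b
    by (rule trans[OF dV_dV_commute[OF smooth_dV[OF f] x]]) (intro dV_cong dV_dV_commute f x)
  then show ?thesis
    unfolding Omega0_def
    by (simp add: dV_sum smooth_on_sum smooth_on_mult smooth_coordinate smooth_dV openU f x
        dV_coordinate_mult)
qed

lemma Omega0_Omega0_commute:
  assumes f: "smooth_on U f" and x: "x \<in> U"
  shows "Omega0 k l (Omega0 p q f) x = Omega0 p q (Omega0 k l f) x"
proof -
  \<comment> \<open>Both compositions get the same normal form: products of coefficients times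
    fourth-order derivatives in \<open>V\<close>.\<close>
  have expand: "Omega0 k l (Omega0 p q f) x = (\<Sum>a\<in>UNIV. \<Sum>b\<in>UNIV. \<Sum>c\<in>UNIV. \<Sum>d\<in>UNIV.
      fst x $ a $ b * (fst x $ c $ d * dV p c (dV q d (dV k a (dV l b f))) x))" for k l p q
  proof -
    have "dV k a (dV l b (Omega0 p q f)) x = Omega0 p q (dV k a (dV l b f)) x" for a b
      by (rule trans[OF dV_cong dV_Omega0_commute[OF smooth_dV[OF f] x]])
        (rule dV_Omega0_commute[OF f], assumption, rule x)
    then show ?thesis
      unfolding Omega0_def[of k l] by (simp add: Omega0_def sum_distrib_left)
  qed
  have swap: "dV p c (dV q d (dV k a (dV l b f))) x = dV k a (dV l b (dV p c (dV q d f))) x" for a b c d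
  proof -
    have move: "dV p c (dV k a (dV l b g)) y = dV k a (dV l b (dV p c g)) y"
      if "smooth_on U g" "y \<in> U" for p c g y
      by (rule trans[OF dV_dV_commute[OF smooth_dV[OF that(1)] that(2)]])
        (intro dV_cong dV_dV_commute that)
    show ?thesis
      by (rule trans[OF dV_cong move[OF smooth_dV[OF f] x]]) (rule move[OF f], assumption, rule x)
  qed
  have sum_swap: "(\<Sum>a\<in>UNIV. \<Sum>b\<in>UNIV. \<Sum>c\<in>UNIV. \<Sum>d\<in>UNIV. F a b c d)
      = (\<Sum>c\<in>UNIV. \<Sum>d\<in>UNIV. \<Sum>a\<in>UNIV. \<Sum>b\<in>UNIV. F a b c d)"
    for F :: "'n \<Rightarrow> 'n \<Rightarrow> 'n \<Rightarrow> 'n \<Rightarrow> real"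
  proof -
    have "(\<Sum>a\<in>UNIV. \<Sum>b\<in>UNIV. \<Sum>c\<in>UNIV. \<Sum>d\<in>UNIV. F a b c d)
        = (\<Sum>a\<in>UNIV. \<Sum>c\<in>UNIV. \<Sum>b\<in>UNIV. \<Sum>d\<in>UNIV. F a b c d)"
      by (rule sum.cong[OF refl], rule sum.swap)
    also have "\<dots> = (\<Sum>c\<in>UNIV. \<Sum>a\<in>UNIV. \<Sum>b\<in>UNIV. \<Sum>d\<in>UNIV. F a b c d)"
      by (rule sum.swap)
    also have "\<dots> = (\<Sum>c\<in>UNIV. \<Sum>a\<in>UNIV. \<Sum>d\<in>UNIV. \<Sum>b\<in>UNIV. F a b c d)"
      by (rule sum.cong[OF refl], rule sum.cong[OF refl], rule sum.swap)
    also have "\<dots> = (\<Sum>c\<in>UNIV. \<Sum>d\<in>UNIV. \<Sum>a\<in>UNIV. \<Sum>b\<in>UNIV. F a b c d)"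
      by (rule sum.cong[OF refl], rule sum.swap)
    finally show ?thesis .
  qed
  show ?thesis
    unfolding expand swap by (rule trans[OF sum_swap]) (simp add: mult.left_commute)
qed

section \<open>Homogeneity of \<open>Omega0\<close> under the Euler operator\<close>

lemma M2Y_dV_commute:
  assumes f: "smooth_on U f" and x: "x \<in> U"
  shows "M2Y i j (dV p a f) x = dV p a (M2Y i j f) x"
proof -
  have "dV p a (M2Y i j f) x = (\<Sum>l\<in>UNIV. dV p a (\<lambda>x. fst x $ i $ l * (2 * dY l j f x)) x)"
    unfolding M2Y_def mult.commute[of 2] mult.assoc
    by (intro dV_sum smooth_on_mult smooth_on_const smooth_coordinate smooth_dY openU f x)
  also have "\<dots> = (\<Sum>l\<in>UNIV. fst x $ i $ l * (2 * dV p a (dY l j f) x))"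
    using dderiv_mult[OF openU smooth_on_const smooth_dY[OF f] x, of 2]
    by (simp add: dV_coordinate_mult smooth_on_mult smooth_on_const smooth_dY openU f x) 
      (simp add: dV_def)
  also have "\<dots> = M2Y i j (dV p a f) x"
    unfolding M2Y_def dV_def dY_eq
    by (simp add: dderiv_commute[OF openU f x, of "(symE _ _, 0)"] ac_simps)
  finally show ?thesis ..
qed

lemma Dop_1: "Dop 1 g = (\<lambda>x. \<Sum>i\<in>UNIV. M2Y i i g x)"
proof -
  \<comment> \<open>The innermost factor is the zeroth power, the identity matrix, so only the
    diagonal entries contribute.\<close>
  have "M2Y i l (if l = i then g else (\<lambda>x. 0)) x = (if i = l then M2Y i i g x else 0)" for i l x
    by (simp add: M2Y_const)
  then show ?thesis by (simp add: Dop_def)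
qed

text \<open>\<open>Dop 1\<close> is a derivation commuting with every \<open>dV\<close>, so the
  commutator only sees the coefficients: applied to \<open>y_ab\<close> it gives
  \<open>y_ba + y_ab\<close>, which is \<open>2 y_ab\<close> on \<open>Pnm\<close>.\<close>

lemma Dop_1_Omega0_commutator:
  assumes f: "smooth_on U f" and x: "x \<in> Pnm"
  shows "Dop 1 (Omega0 p q f) x = Omega0 p q (Dop 1 f) x + 2 * Omega0 p q f x"
proof -
  have xU: "x \<in> U" using x by (rule PnmD)
  have inner: "dV p a (dV q b (Dop 1 f)) x = (\<Sum>i\<in>UNIV. M2Y i i (dV p a (dV q b f)) x)" for a b
  proof -
    have "dV p a (dV q b (Dop 1 f)) x = dV p a (\<lambda>y. \<Sum>i\<in>UNIV. M2Y i i (dV q b f) y) x"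
      by (rule dV_cong) (simp_all add: Dop_1 dV_sum smooth_M2Y f M2Y_dV_commute xU del: One_nat_def)
    also have "\<dots> = (\<Sum>i\<in>UNIV. M2Y i i (dV p a (dV q b f)) x)"
      by (simp add: dV_sum smooth_M2Y smooth_dV f M2Y_dV_commute xU)
    finally show ?thesis .
  qed
  have "Dop 1 (Omega0 p q f) x = (\<Sum>i\<in>UNIV. \<Sum>a\<in>UNIV. \<Sum>b\<in>UNIV.
      M2Y i i (\<lambda>x. fst x $ a $ b * dV p a (dV q b f) x) x)"
    unfolding Dop_1 Omega0_def
    by (simp add: M2Y_sum smooth_on_sum smooth_on_mult smooth_coordinate smooth_dV openU f xU)
  also have "\<dots> = (\<Sum>a\<in>UNIV. \<Sum>b\<in>UNIV. \<Sum>i\<in>UNIV.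
      M2Y i i (\<lambda>x. fst x $ a $ b * dV p a (dV q b f) x) x)"
    by (subst sum.swap) (rule sum.cong[OF refl], rule sum.swap)
  also have "\<dots> = (\<Sum>a\<in>UNIV. \<Sum>b\<in>UNIV. fst x $ a $ b * dV p a (dV q b (Dop 1 f)) x
      + 2 * (fst x $ a $ b * dV p a (dV q b f) x))"
  proof (intro sum.cong refl)
    fix a b
    have "(\<Sum>i\<in>UNIV. M2Y i i (\<lambda>x. fst x $ a $ b * dV p a (dV q b f) x) x)
      = (\<Sum>i\<in>UNIV. fst x $ a $ b * M2Y i i (dV p a (dV q b f)) x
        + (of_bool (b = i) * fst x $ i $ a + of_bool (a = i) * fst x $ i $ b) * dV p a (dV q b f) x)"
      by (simp add: M2Y_mult smooth_coordinate smooth_dV f xU M2Y_coordinate mult.commute)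
    also have "\<dots> = fst x $ a $ b * dV p a (dV q b (Dop 1 f)) x
        + (fst x $ b $ a + fst x $ a $ b) * dV p a (dV q b f) x"
      by (simp add: sum.distrib sum_distrib_right[symmetric] sum_distrib_left[symmetric] inner
          del: One_nat_def)
    finally show "(\<Sum>i\<in>UNIV. M2Y i i (\<lambda>x. fst x $ a $ b * dV p a (dV q b f) x) x)
      = fst x $ a $ b * dV p a (dV q b (Dop 1 f)) x + 2 * (fst x $ a $ b * dV p a (dV q b f) x)"
      using Pnm_symmetric[OF x, of b a] by simp
  qed
  also have "\<dots> = Omega0 p q (Dop 1 f) x + 2 * Omega0 p q f x"
    by (simp add: Omega0_def sum.distrib sum_distrib_left)
  finally show ?thesis .
qed

end

theorem theorem4p1:
  fixes U :: "(('n::finite,'m::{finite,linorder}) pt) set"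
    and f :: "('n,'m) pt \<Rightarrow> real"
  assumes "open U" and "Pnm \<subseteq> U" and "smooth_on U f"
  shows "(\<forall>i j. 1 \<le> i \<and> i \<le> CARD('n) \<and> 1 \<le> j \<and> j \<le> CARD('n) \<longrightarrow>
            (\<forall>x\<in>Pnm. Dop i (Dop j f) x - Dop j (Dop i f) x = 0))
       \<and> (\<forall>k l p q. k \<le> l \<and> p \<le> q \<longrightarrow>
            (\<forall>x\<in>Pnm. Omega0 k l (Omega0 p q f) x - Omega0 p q (Omega0 k l f) x = 0))
       \<and> (\<forall>p q. p \<le> q \<longrightarrow>
            (\<forall>x\<in>Pnm. Dop 1 (Omega0 p q f) x - Omega0 p q (Dop 1 f) x = 2 * Omega0 p q f x))"
proof -
  interpret Pnm_neighbourhood U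
    using assms by unfold_locales
  show ?thesis
    using assms(3) Dop_Dop_commute Omega0_Omega0_commute PnmD Dop_1_Omega0_commutator by simp
qed

end
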